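(* Let $T$ be a translatable semigroup and $G$ its Grothendieck group. Then for any integers $h,k\ge 1$ we have $E_T(h,k)=E_G(h,k)$.
   Context: For subsets $A,B$ of an abelian semigroup, $A\sim B$ means that the symmetric difference of $A$ and $B$ is finite. A translatable semigroup is an infinite cancellative abelian semigroup $(T,+)$ such that for every $x\in T$ the set $T\setminus(x+T)$ is finite; every infinite abelian group is translatable. A cancellative abelian semigroup $T$ embeds in its Grothendieck group $G=G_T$, an abelian group with $G=T-T$. Let $S$ be a translatable semigroup (here $S=T$ or $S=G$). $hA$ denotes the $h$-fold Minkowski sum $A+\cdots+A$ ($h\ge 1$ copies). A subset $A\subset S$ is an additive basis of $S$ if $hA\sim S$ for some integer $h\ge 1$. A subset $F$ of an additive basis $A$ is exceptional if $A\setminus F$ is not an additive basis of $S$. An essential subset of $A$ is a finite exceptional subset of $A$ that is minimal, with respect to inclusion, among the exceptional subsets of $A$. For integers $h,k\ge 1$, $E_S(h,k)$ is the maximum, over all $A\subset S$ with $hA\sim S$, of the number of essential subsets $F$ of $A$ with $|F|=k$ (a priori a supremum, possibly infinite). *)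

theory Defs
  imports Main "HOL-Library.Set_Algebras" "HOL-Library.Extended_Nat"
begin

(* The library class cancel_ab_semigroup_add is not used: it also fixes a
   subtraction subject to axioms that a cancellative abelian semigroup need
   not come with. *)

class translatable_semigroup = ab_semigroup_add + cancel_semigroup_add +
  assumes infinite_semigroup: "infinite (UNIV :: 'a set)"
    and finite_Compl_translate: "finite (UNIV - range ((+) (x :: 'a)))"

(* The Grothendieck group of 'a: a pair (a, b) stands for the formal
   difference a - b. *)

definition groth_rel ::
    "'a::{ab_semigroup_add, cancel_semigroup_add} \<times> 'a \<Rightarrow> 'a \<times> 'a \<Rightarrow> bool"
  where "groth_rel p q \<longleftrightarrow> fst p + snd q = fst q + snd p"

lemma groth_rel_Pair [simp]: "groth_rel (a, b) (c, d) \<longleftrightarrow> a + d = c + b"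
  by (simp add: groth_rel_def)

lemma groth_rel_trans:
  assumes "groth_rel p q" and "groth_rel q r"
  shows "groth_rel p r"
proof -
  obtain a b c d e f where pqr: "p = (a, b)" "q = (c, d)" "r = (e, f)"
    by (metis surj_pair)
  with assms have h: "a + d = c + b" "c + f = e + d"
    by simp_all
  have "d + (a + f) = (a + d) + f"
    by (simp only: ac_simps)
  also have "\<dots> = (c + f) + b"
    unfolding h(1) by (simp only: ac_simps)
  also have "\<dots> = d + (e + b)"
    unfolding h(2) by (simp only: ac_simps)
  finally show ?thesis
    unfolding pqr by (auto dest: add_left_imp_eq)
qed

lemma equivp_groth_rel: "equivp groth_rel"
proof (rule equivpI)
  show "reflp groth_rel"
    by (auto intro: reflpI simp: groth_rel_def)
  show "symp groth_rel"
    by (auto intro: sympI simp: groth_rel_def)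
  show "transp groth_rel"
    by (rule transpI) (rule groth_rel_trans)
qed

quotient_type (overloaded) 'a grothendieck =
    "'a::{ab_semigroup_add, cancel_semigroup_add} \<times> 'a" / groth_rel
  by (rule equivp_groth_rel)

instantiation grothendieck :: ("{ab_semigroup_add, cancel_semigroup_add}") ab_group_add
begin

lift_definition zero_grothendieck :: "'a grothendieck"
  is "(undefined, undefined)" .

lift_definition plus_grothendieck ::
    "'a grothendieck \<Rightarrow> 'a grothendieck \<Rightarrow> 'a grothendieck"
  is "\<lambda>(a, b) (c, d). (a + c, b + d)"
proof (clarsimp)
  fix a b a' b' c d c' d' :: 'a
  assume h: "a + b' = a' + b" "c + d' = c' + d"
  have "a + c + (b' + d') = (a + b') + (c + d')"
    by (simp add: ac_simps)
  also have "\<dots> = a' + c' + (b + d)"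
    unfolding h by (simp add: ac_simps)
  finally show "a + c + (b' + d') = a' + c' + (b + d)" .
qed

lift_definition uminus_grothendieck :: "'a grothendieck \<Rightarrow> 'a grothendieck"
  is "\<lambda>(a, b). (b, a)"
  by (auto simp: ac_simps)

definition minus_grothendieck ::
    "'a grothendieck \<Rightarrow> 'a grothendieck \<Rightarrow> 'a grothendieck"
  where "minus_grothendieck g h = g + - h"

instance
proof
  fix g h k :: "'a grothendieck"
  show "g + h + k = g + (h + k)"
    by transfer (auto simp: ac_simps)
  show "g + h = h + g"
    by transfer (auto simp: ac_simps)
  show "0 + g = g"
    by transfer (auto simp: ac_simps)
  show "- g + g = 0"
    by transfer (auto simp: ac_simps)
  show "g - h = g + - h"
    by (rule minus_grothendieck_def)
qed

end

(* The canonical map T \<rightarrow> G; x is sent to (x + c) - c for an arbitrary c, because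
   T need not have a neutral element. *)

lift_definition groth_embed ::
    "'a::{ab_semigroup_add, cancel_semigroup_add} \<Rightarrow> 'a grothendieck"
  is "\<lambda>x. (x + undefined, undefined)" .

lemma groth_embed_add: "groth_embed (x + y) = groth_embed x + groth_embed y"
  by transfer (simp add: ac_simps)

lemma inj_groth_embed: "inj groth_embed"
proof (rule injI)
  fix x y :: 'a
  assume "groth_embed x = groth_embed y"
  then have "x + undefined + undefined = y + undefined + undefined"
    by transfer simp
  then show "x = y"
    by (auto dest: add_right_imp_eq)
qed

lemma groth_embed_diff_surj: "\<exists>x y. g = groth_embed x - groth_embed y"
  unfolding minus_grothendieck_def
proof transfer
  fix p :: "'a \<times> 'a"
  have "groth_rel p ((\<lambda>(a, b) (c, d). (a + c, b + d)) (fst p + undefined, undefined)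
      ((\<lambda>(a, b). (b, a)) (snd p + undefined, undefined)))"
    by (simp add: groth_rel_def ac_simps)
  then show "\<exists>x y. groth_rel p ((\<lambda>(a, b) (c, d). (a + c, b + d)) (x + undefined, undefined)
      ((\<lambda>(a, b). (b, a)) (y + undefined, undefined)))"
    by blast
qed

instance grothendieck :: (translatable_semigroup) translatable_semigroup
proof
  show "infinite (UNIV :: 'a grothendieck set)"
    using infinite_semigroup inj_groth_embed
    by (metis finite_imageD finite_subset subset_UNIV)
next
  fix g :: "'a grothendieck"
  have "range ((+) g) = UNIV"
    by (rule surj_plus)
  then show "finite (UNIV - range ((+) g))"
    by simp
qed

definition almost_eq :: "'a set \<Rightarrow> 'a set \<Rightarrow> bool"  (infix "\<sim>" 50)
  where "A \<sim> B \<longleftrightarrow> finite (sym_diff A B)"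

(* Only h \<ge> 1 is meaningful: without a neutral element there is no empty sum. *)

fun sumset :: "nat \<Rightarrow> 'a::ab_semigroup_add set \<Rightarrow> 'a set"
  where
    "sumset 0 A = {}"
  | "sumset (Suc 0) A = A"
  | "sumset (Suc (Suc h)) A = A + sumset (Suc h) A"

definition additive_basis :: "'a::translatable_semigroup set \<Rightarrow> bool"
  where "additive_basis A \<longleftrightarrow> (\<exists>h\<ge>1. sumset h A \<sim> UNIV)"

definition exceptional :: "'a::translatable_semigroup set \<Rightarrow> 'a set \<Rightarrow> bool"
  where "exceptional A F \<longleftrightarrow> additive_basis A \<and> F \<subseteq> A \<and> \<not> additive_basis (A - F)"

definition essential :: "'a::translatable_semigroup set \<Rightarrow> 'a set \<Rightarrow> bool"
  where "essential A F \<longleftrightarrow>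
    finite F \<and> exceptional A F \<and> (\<forall>F'. exceptional A F' \<and> F' \<subseteq> F \<longrightarrow> F' = F)"

definition ecard :: "'a set \<Rightarrow> enat"
  where "ecard X = (if finite X then enat (card X) else \<infinity>)"

definition max_essential :: "'a::translatable_semigroup itself \<Rightarrow> nat \<Rightarrow> nat \<Rightarrow> enat"
  where "max_essential S h k =
    (SUP A \<in> {A :: 'a set. sumset h A \<sim> UNIV}. ecard {F. essential A F \<and> card F = k})"

end

theory Submission
  imports Defs
begin

text \<open>
  Everything takes place in the group \<open>G\<close>, relative to a subsemigroup \<open>P\<close>, which is
  either the image of \<open>T\<close> or \<open>G\<close> itself. Let \<open>A\<close> be a basis of \<open>P\<close>. If a finite set
  \<open>F\<close> is removed and the differences of \<open>A - F\<close> still generate \<open>G\<close>, then \<open>A - F\<close> is a basis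
  (Erdos--Graham). Hence for essential sets \<open>F\<^sub>1, \<dots>, F\<^sub>n\<close> of \<open>A\<close> the set \<open>A - F\<^sub>i\<close> lies in a coset
  \<open>c + K\<^sub>i\<close> of a proper subgroup, and \<open>A\<close> is contained in the union of the finite set
  \<open>U = F\<^sub>1 \<union> \<dots> \<union> F\<^sub>n\<close> and the coset \<open>c + H\<close> with \<open>H = K\<^sub>1 \<inter> \<dots> \<inter> K\<^sub>n\<close>. Finitely many cosets of \<open>H\<close>
  thus cover \<open>P\<close>, so \<open>P\<close> maps onto a finite subsemigroup of \<open>G/H\<close>, which is a group;
  therefore \<open>H\<close> has finite index and \<open>P\<close> meets every coset of \<open>H\<close> in an infinite set. Given another
  such subsemigroup \<open>Q\<close>, choose \<open>t\<close> with \<open>t + U \<subseteq> Q\<close> and put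
  \<open>B = (t + U) \<union> (Q \<inter> (t + c + H))\<close>. Whether \<open>B\<close> minus a subset of \<open>t + U\<close> is a basis
  of \<open>Q\<close> is governed by sums in \<open>G/H\<close> with at least one summand \<open>c\<close>, so the order of \<open>B\<close> is at most that of
  \<open>A\<close> and every \<open>t + F\<^sub>i\<close> is essential in \<open>B\<close>.
\<close>

section \<open>Iterated sums in a group, with \<open>{0}\<close> as the empty sum\<close>

primrec nsum :: "nat \<Rightarrow> 'g::ab_group_add set \<Rightarrow> 'g set"
  where
    "nsum 0 A = {0}"
  | "nsum (Suc n) A = A + nsum n A"

lemma nsum_mono: "A \<subseteq> B \<Longrightarrow> nsum n A \<subseteq> nsum n B"
  by (induction n) (simp_all add: set_plus_mono2)

lemma finite_nsum: "finite A \<Longrightarrow> finite (nsum n A)"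
  by (induction n) (auto intro: finite_set_plus)

lemma nsum_add: "x \<in> nsum m A \<Longrightarrow> y \<in> nsum n A \<Longrightarrow> x + y \<in> nsum (m + n) A"
proof (induction m arbitrary: x)
  case (Suc m)
  then obtain a z where "x = a + z" "a \<in> A" "z \<in> nsum m A"
    by (auto elim: set_plus_elim)
  then have "x + y = a + (z + y)" "z + y \<in> nsum (m + n) A"
    using Suc by (auto simp: add.assoc)
  then show ?case
    using \<open>a \<in> A\<close> by (auto simp: add.assoc)
qed simp

lemma nsum_SucE:
  assumes "x \<in> nsum (Suc n) A"
  obtains a y where "x = a + y" "a \<in> A" "y \<in> nsum n A"
  using assms unfolding nsum.simps by (rule set_plus_elim)

text \<open>By commutativity a summand lying in \<open>W\<close> can be moved to the front; if there
  is none, all summands lie in \<open>U\<close>. For finite \<open>U\<close> the second case gives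
  only finitely many sums.\<close>

lemma nsum_Suc_split:
  assumes "A \<subseteq> U \<union> W"
  shows "nsum (Suc n) A \<subseteq> nsum (Suc n) U \<union> (W + nsum n A)"
proof (induction n)
  case 0
  then show ?case
    using assms by auto
next
  case (Suc n)
  show ?case
  proof
    fix z
    assume "z \<in> nsum (Suc (Suc n)) A"
    then obtain a y where z: "z = a + y" and a: "a \<in> A" and y: "y \<in> nsum (Suc n) A"
      unfolding nsum.simps(2)[of "Suc n"] by (rule set_plus_elim)
    consider "a \<in> W" | "a \<in> U" "y \<in> nsum (Suc n) U" | "y \<in> W + nsum n A"
      using a y assms Suc by blast
    then show "z \<in> nsum (Suc (Suc n)) U \<union> (W + nsum (Suc n) A)"
    proof cases
      case 1
      then show ?thesis
        using z y by blast
    next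
      case 2
      then show ?thesis
        using z by auto
    next
      case 3
      then obtain w v where "y = w + v" "w \<in> W" "v \<in> nsum n A"
        by (rule set_plus_elim)
      then have "z = w + (a + v)" "a + v \<in> nsum (Suc n) A"
        using z a by (auto simp: ac_simps)
      then show ?thesis
        using \<open>w \<in> W\<close> by blast
    qed
  qed
qed

section \<open>Subgroups and cosets\<close>

definition add_subgroup :: "'g::ab_group_add set \<Rightarrow> bool"
  where "add_subgroup H \<longleftrightarrow> 0 \<in> H \<and> (\<forall>x\<in>H. \<forall>y\<in>H. x - y \<in> H)"

lemma add_subgroup_zero: "add_subgroup H \<Longrightarrow> 0 \<in> H"
  and add_subgroup_diff: "add_subgroup H \<Longrightarrow> x \<in> H \<Longrightarrow> y \<in> H \<Longrightarrow> x - y \<in> H"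
  by (auto simp: add_subgroup_def)

lemma add_subgroup_uminus: "add_subgroup H \<Longrightarrow> x \<in> H \<Longrightarrow> - x \<in> H"
  using add_subgroup_diff[of H 0 x] by (simp add: add_subgroup_zero)

lemma add_subgroup_add: "add_subgroup H \<Longrightarrow> x \<in> H \<Longrightarrow> y \<in> H \<Longrightarrow> x + y \<in> H"
  using add_subgroup_diff[of H x "- y"] by (simp add: add_subgroup_uminus)

lemma add_subgroup_INT:
  "(\<And>i. i \<in> I \<Longrightarrow> add_subgroup (K i)) \<Longrightarrow> add_subgroup (\<Inter>i\<in>I. K i)"
  by (auto simp: add_subgroup_def)

lemma coset_eqI:
  assumes "add_subgroup H" "x - r \<in> H"
  shows "(+) x ` H = (+) r ` H"
proof -
  have *: "(+) x ` H \<subseteq> (+) r ` H" if "x - r \<in> H" for x r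
  proof
    fix z assume "z \<in> (+) x ` H"
    then obtain y where "z = x + y" "y \<in> H"
      by blast
    then have "z = r + ((x - r) + y)" "(x - r) + y \<in> H"
      using add_subgroup_add[OF assms(1) that] by auto
    then show "z \<in> (+) r ` H"
      by blast
  qed
  show ?thesis
    using *[OF assms(2)] *[of r x] add_subgroup_uminus[OF assms] by auto
qed

lemma coset_eqD:
  assumes "add_subgroup H" "(+) x ` H = (+) r ` H"
  shows "x - r \<in> H"
proof -
  have "x + 0 \<in> (+) r ` H"
    using assms add_subgroup_zero by blast
  then show ?thesis
    by auto
qed

text \<open>This is the subgroup generated by \<open>A - A\<close>, written through pairs of sums of
  equal length.\<close>

definition diff_subgroup :: "'g::ab_group_add set \<Rightarrow> 'g set"
  where "diff_subgroup A = (\<Union>n. {x - y | x y. x \<in> nsum n A \<and> y \<in> nsum n A})"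

lemma diff_subgroup_mono: "A \<subseteq> B \<Longrightarrow> diff_subgroup A \<subseteq> diff_subgroup B"
  using nsum_mono[of A B] unfolding diff_subgroup_def by (fastforce dest: subsetD)

lemma diff_subgroupI: "x \<in> nsum n A \<Longrightarrow> y \<in> nsum n A \<Longrightarrow> x - y \<in> diff_subgroup A"
  unfolding diff_subgroup_def by blast

lemma add_subgroup_diff_subgroup: "add_subgroup (diff_subgroup A)"
  unfolding add_subgroup_def
proof (intro conjI ballI)
  show "0 \<in> diff_subgroup A"
    using diff_subgroupI[of 0 0 A 0] by simp
  fix g k
  assume "g \<in> diff_subgroup A" "k \<in> diff_subgroup A"
  then obtain m n x y u v where "g = x - y" "x \<in> nsum m A" "y \<in> nsum m A"
    and "k = u - v" "u \<in> nsum n A" "v \<in> nsum n A"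
    unfolding diff_subgroup_def by blast
  then have "g - k = (x + v) - (y + u)" "x + v \<in> nsum (m + n) A" "y + u \<in> nsum (m + n) A"
    by (auto intro: nsum_add)
  then show "g - k \<in> diff_subgroup A"
    using diff_subgroupI by metis
qed

section \<open>Bases and essential subsets relative to a subset of a group\<close>

definition basis_of :: "'g::ab_group_add set \<Rightarrow> 'g set \<Rightarrow> bool"
  where "basis_of P A \<longleftrightarrow> (\<exists>n\<ge>1. finite (P - nsum n A))"

definition exceptional_of :: "'g::ab_group_add set \<Rightarrow> 'g set \<Rightarrow> 'g set \<Rightarrow> bool"
  where "exceptional_of P A F \<longleftrightarrow> basis_of P A \<and> F \<subseteq> A \<and> \<not> basis_of P (A - F)"

definition essential_of :: "'g::ab_group_add set \<Rightarrow> 'g set \<Rightarrow> 'g set \<Rightarrow> bool"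
  where "essential_of P A F \<longleftrightarrow>
    finite F \<and> exceptional_of P A F \<and> (\<forall>F'. exceptional_of P A F' \<and> F' \<subseteq> F \<longrightarrow> F' = F)"

text \<open>For \<open>P\<close> closed under addition, \<open>A \<subseteq> P\<close> and
  \<open>h \<ge> 1\<close>, sums stay in \<open>P\<close>, so this one-sided finiteness is almost
  equality with \<open>P\<close>.\<close>

definition max_essential_of :: "'g::ab_group_add set \<Rightarrow> nat \<Rightarrow> nat \<Rightarrow> enat"
  where "max_essential_of P h k =
    (SUP A \<in> {A. A \<subseteq> P \<and> finite (P - nsum h A)}. ecard {F. essential_of P A F \<and> card F = k})"

section \<open>Translatable subsemigroups generating the group\<close>

locale translatable_subset =
  fixes P :: "'g::ab_group_add set"
  assumes add_closed: "x \<in> P \<Longrightarrow> y \<in> P \<Longrightarrow> x + y \<in> P"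
    and infinite_P: "infinite P"
    and finite_Diff_translate: "x \<in> P \<Longrightarrow> finite (P - (+) x ` P)"
    and differences: "\<exists>x\<in>P. \<exists>y\<in>P. g = x - y"
begin

lemma nsum_subset: "A \<subseteq> P \<Longrightarrow> nsum n A \<subseteq> insert 0 P"
proof (induction n)
  case (Suc n)
  show ?case
  proof
    fix x
    assume "x \<in> nsum (Suc n) A"
    then obtain a y where "x = a + y" "a \<in> A" "y \<in> nsum n A"
      by (rule nsum_SucE)
    then show "x \<in> insert 0 P"
      using Suc add_closed by fastforce
  qed
qed simp

lemma finite_Diff_translate_nsum:
  assumes "A \<subseteq> P" "x \<in> nsum n A"
  shows "finite (P - (+) x ` P)"
proof -
  have "x = 0 \<or> x \<in> P"
    using nsum_subset[OF assms(1)] assms(2) by blast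
  then show ?thesis
    using finite_Diff_translate by auto
qed

lemma infinite_basis: "finite (P - nsum n A) \<Longrightarrow> infinite A"
  using infinite_P finite_nsum[of A n] finite_Diff2 by blast

text \<open>Translation by \<open>y \<in> P\<close> is an injective self-map of the finite set of
  cosets meeting \<open>P\<close>, hence onto. So for \<open>g = x - y\<close> the coset of
  \<open>x\<close> is that of some \<open>y + z\<close> with \<open>z \<in> P\<close>, and
  \<open>z\<close> represents \<open>g\<close>.\<close>

lemma coset_representatives:
  assumes H: "add_subgroup H" and R: "finite R" "\<And>x. x \<in> P \<Longrightarrow> \<exists>r\<in>R. x - r \<in> H"
  shows "\<exists>x\<in>P. g - x \<in> H"
proof -
  define Q where "Q = (\<lambda>x. (+) x ` H) ` P"
  have "Q \<subseteq> (\<lambda>x. (+) x ` H) ` R"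
    unfolding Q_def using R(2) coset_eqI[OF H] by (smt (verit) image_iff subsetI)
  then have "finite Q"
    using R(1) finite_surj by blast
  obtain x y where g: "x \<in> P" "y \<in> P" "g = x - y"
    using differences by blast
  have eq: "(`) ((+) y) ((+) z ` H) = (+) (y + z) ` H" for z
    by (auto simp: image_image add.assoc)
  have "inj_on ((`) ((+) y)) Q"
    by (auto simp: inj_on_def inj_image_eq_iff)
  moreover have "(`) ((+) y) ` Q \<subseteq> Q"
    unfolding Q_def using eq add_closed[OF g(2)] by fast
  ultimately have "(`) ((+) y) ` Q = Q"
    using \<open>finite Q\<close> by (intro endo_inj_surj)
  moreover have "(+) x ` H \<in> Q"
    unfolding Q_def using g(1) by blast
  ultimately obtain z where "z \<in> P" "(+) x ` H = (+) (y + z) ` H"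
    unfolding Q_def using eq by (smt (verit, ccfv_threshold) image_iff)
  then have "x - (y + z) \<in> H"
    using coset_eqD[OF H] by blast
  then show ?thesis
    using \<open>z \<in> P\<close> g(3) by (auto simp: algebra_simps)
qed

text \<open>If one coset met \<open>P\<close> in a finite set, suitable translations by elements of
  \<open>P\<close> would inject the part of \<open>P\<close> in any other coset into it, and
  \<open>P\<close> would be finite.\<close>

lemma infinite_coset:
  assumes H: "add_subgroup H" and R: "finite R" "\<And>x. x \<in> P \<Longrightarrow> \<exists>r\<in>R. x - r \<in> H"
  shows "infinite {x \<in> P. g - x \<in> H}"
proof
  assume fin: "finite {x \<in> P. g - x \<in> H}"
  have "finite {x \<in> P. x - r \<in> H}" for r
  proof -
    obtain p where p: "p \<in> P" "(g - r) - p \<in> H"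
      using coset_representatives[OF assms] by blast
    have "(+) p ` {x \<in> P. x - r \<in> H} \<subseteq> {x \<in> P. g - x \<in> H}"
    proof clarify
      fix x assume x: "x \<in> P" "x - r \<in> H"
      have "((g - r) - p) - (x - r) \<in> H"
        using add_subgroup_diff[OF H p(2) x(2)] .
      then show "p + x \<in> P \<and> g - (p + x) \<in> H"
        using p(1) x(1) add_closed by (simp add: algebra_simps)
    qed
    then have "finite ((+) p ` {x \<in> P. x - r \<in> H})"
      using fin finite_subset by blast
    then show ?thesis
      by (rule finite_imageD) simp
  qed
  then have "finite (\<Union>r\<in>R. {x \<in> P. x - r \<in> H})"
    using R(1) by blast
  moreover have "P \<subseteq> (\<Union>r\<in>R. {x \<in> P. x - r \<in> H})"
    using R(2) by blast
  ultimately show False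
    using infinite_P finite_subset by blast
qed

text \<open>Modulo \<open>H\<close> the summands come from the finite set \<open>insert c U\<close>,
  so \<open>n\<close>-fold sums take finitely many classes; the finitely many missing elements of
  \<open>P\<close> are added to the representatives.\<close>

lemma finite_cosets_of_basis:
  assumes H: "add_subgroup H" and A: "finite (P - nsum n A)"
    and U: "finite U" "\<And>a. a \<in> A \<Longrightarrow> a \<in> U \<or> a - c \<in> H"
  obtains R where "finite R" "\<And>g. \<exists>r\<in>R. g - r \<in> H"
proof -
  have "\<exists>r\<in>nsum m (insert c U). x - r \<in> H" if "x \<in> nsum m A" for m x
    using that
  proof (induction m arbitrary: x)
    case 0
    then show ?case
      using add_subgroup_zero[OF H] by simp
  next
    case (Suc m)
    then obtain a y where x: "x = a + y" "a \<in> A" "y \<in> nsum m A"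
      by (auto elim: set_plus_elim)
    obtain r where r: "r \<in> nsum m (insert c U)" "y - r \<in> H"
      using Suc.IH[OF x(3)] by blast
    obtain b where b: "b \<in> insert c U" "a - b \<in> H"
      using U(2)[OF x(2)] add_subgroup_zero[OF H] by (metis diff_self insert_iff)
    have "x - (b + r) \<in> H"
      using add_subgroup_add[OF H b(2) r(2)] x(1) by (simp add: algebra_simps)
    then show ?case
      using b(1) r(1) by (auto intro!: bexI[of _ "b + r"] simp: set_plus_intro)
  qed
  then have *: "\<exists>r\<in>nsum n (insert c U) \<union> (P - nsum n A). x - r \<in> H" if "x \<in> P" for x
    using that add_subgroup_zero[OF H] by (metis Diff_iff UnCI diff_self)
  have fin: "finite (nsum n (insert c U) \<union> (P - nsum n A))"
    using U(1) A finite_nsum[of "insert c U" n] by simp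
  show thesis
  proof (rule that[OF fin])
    fix g
    obtain p where p: "p \<in> P" "g - p \<in> H"
      using coset_representatives[OF H fin *] by blast
    obtain r where r: "r \<in> nsum n (insert c U) \<union> (P - nsum n A)" "p - r \<in> H"
      using *[OF p(1)] by blast
    have "g - r \<in> H"
      using add_subgroup_add[OF H p(2) r(2)] by simp
    then show "\<exists>r\<in>nsum n (insert c U) \<union> (P - nsum n A). g - r \<in> H"
      using r(1) by blast
  qed
qed

text \<open>All \<open>n\<close>-fold sums lie in one coset of \<open>H\<close>, whereas almost all
  of \<open>P\<close> meets every coset.\<close>

lemma not_basis_of_coset:
  assumes H: "add_subgroup H" "H \<noteq> UNIV" and R: "finite R" "\<And>g. \<exists>r\<in>R. g - r \<in> H"
    and A: "\<And>a. a \<in> A \<Longrightarrow> a - c \<in> H"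
  shows "\<not> basis_of P A"
proof
  assume "basis_of P A"
  then obtain n where n: "finite (P - nsum n A)"
    unfolding basis_of_def by blast
  have "\<exists>s. \<forall>x\<in>nsum m A. x - s \<in> H" for m
  proof (induction m)
    case 0
    then show ?case
      using add_subgroup_zero[OF H(1)] by (auto intro: exI[of _ 0])
  next
    case (Suc m)
    then obtain s where s: "\<forall>x\<in>nsum m A. x - s \<in> H" ..
    have "x - (c + s) \<in> H" if "x \<in> nsum (Suc m) A" for x
    proof -
      obtain a y where "x = a + y" "a \<in> A" "y \<in> nsum m A"
        using \<open>x \<in> nsum (Suc m) A\<close> by (rule nsum_SucE)
      then show ?thesis
        using add_subgroup_add[OF H(1) A, of a "y - s"] s by (simp add: algebra_simps)
    qed
    then show ?case
      by blast
  qed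
  then obtain s where s: "\<And>x. x \<in> nsum n A \<Longrightarrow> x - s \<in> H"
    by blast
  have "g \<in> H" for g
  proof -
    have "infinite ({x \<in> P. (g + s) - x \<in> H} - (P - nsum n A))"
      using infinite_coset[OF H(1) R] n by (simp add: Diff_infinite_finite)
    then obtain x where "x \<in> nsum n A" "(g + s) - x \<in> H"
      by (blast dest: infinite_imp_nonempty)
    then show ?thesis
      using add_subgroup_add[OF H(1) s] by fastforce
  qed
  then show False
    using H(2) by blast
qed

section \<open>Removing finitely many elements from a basis\<close>

text \<open>If \<open>a + u = w\<close> with \<open>u\<close> an \<open>n\<close>-fold and \<open>w\<close> an \<open>n + 1\<close>-fold sum of elements other
  than \<open>a\<close>, then adding \<open>h u\<close> to an \<open>h\<close>-fold sum allows every occurrence of \<open>a\<close> to be traded.\<close>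

lemma basis_of_remove1:
  assumes A: "A \<subseteq> P" "basis_of P A" and gen: "diff_subgroup (A - {a}) = UNIV"
  shows "basis_of P (A - {a})"
proof -
  let ?A = "A - {a}"
  obtain h where h: "h \<ge> 1" "finite (P - nsum h A)"
    using A(2) unfolding basis_of_def by blast
  have "infinite ?A"
    using infinite_basis[OF h(2)] by simp
  \<comment> \<open>\<open>b\<close> serves as padding: \<open>a - b = v - u\<close> becomes
    \<open>a + u = b + v\<close>, whose right side has one summand more than
    \<open>u\<close>.\<close>
  then obtain b where b: "b \<in> ?A"
    by (metis ex_in_conv finite.emptyI)
  have "a - b \<in> diff_subgroup ?A"
    using gen by simp
  then obtain n v u where vu: "a - b = v - u" "v \<in> nsum n ?A" "u \<in> nsum n ?A"
    unfolding diff_subgroup_def by blast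
  define w where "w = b + v"
  have w: "a + u = w" "w \<in> nsum (Suc n) ?A"
    using vu b unfolding w_def by (auto simp: algebra_simps)
  have "\<exists>s\<in>nsum (m * n) ?A. \<forall>x\<in>nsum m A. s + x \<in> nsum (m * Suc n) ?A" for m
  proof (induction m)
    case 0
    then show ?case by simp
  next
    case (Suc m)
    then obtain s where s: "s \<in> nsum (m * n) ?A" "\<forall>x\<in>nsum m A. s + x \<in> nsum (m * Suc n) ?A"
      by blast
    have "(u + s) + x \<in> nsum (Suc m * Suc n) ?A" if "x \<in> nsum (Suc m) A" for x
    proof -
      obtain d y where x: "x = d + y" "d \<in> A" "y \<in> nsum m A"
        using \<open>x \<in> nsum (Suc m) A\<close> by (rule nsum_SucE)
      have "u + d \<in> nsum (Suc n) ?A"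
        using w vu(3) x(2) nsum_add[of u n ?A d "Suc 0"]
        by (cases "d = a") (auto simp: ac_simps)
      then have "(u + d) + (s + y) \<in> nsum (Suc n + m * Suc n) ?A"
        using s(2) x(3) by (intro nsum_add) auto
      then show ?thesis
        using x(1) by (simp only: mult_Suc ac_simps)
    qed
    moreover have "u + s \<in> nsum (Suc m * n) ?A"
      using nsum_add[OF vu(3) s(1)] by simp
    ultimately show ?case
      by blast
  qed
  then obtain s where s: "s \<in> nsum (h * n) ?A" "\<And>x. x \<in> nsum h A \<Longrightarrow> s + x \<in> nsum (h * Suc n) ?A"
    by blast
  have "P - nsum (h * Suc n) ?A \<subseteq> (P - (+) s ` P) \<union> (+) s ` (P - nsum h A)"
    using s(2) by blast
  moreover have "finite (P - (+) s ` P)"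
    using finite_Diff_translate_nsum[OF _ s(1)] A(1) by blast
  ultimately have "finite (P - nsum (h * Suc n) ?A)"
    using h(2) by (meson finite_Un finite_imageI finite_subset)
  then show ?thesis
    unfolding basis_of_def using h(1) by (intro exI[of _ "h * Suc n"]) simp
qed

lemma basis_of_remove_finite:
  assumes "finite F" "A \<subseteq> P" "basis_of P A" "diff_subgroup (A - F) = UNIV"
  shows "basis_of P (A - F)"
  using assms
proof (induction F)
  case empty
  then show ?case by simp
next
  case (insert a F)
  have eq: "A - insert a F = (A - F) - {a}"
    by blast
  have "diff_subgroup (A - F) = UNIV"
    using insert.prems(3) diff_subgroup_mono[of "A - insert a F" "A - F"] by blast
  then have "basis_of P (A - F)"
    using insert by blast
  then show ?case
    unfolding eq using insert.prems eq by (intro basis_of_remove1) auto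
qed

section \<open>Essential subsets and cosets\<close>

text \<open>Properness is the removal result. If some \<open>a \<in> F\<close> lay in the coset of
  \<open>A - F\<close>, putting it back would still leave a non-basis, against the minimality of
  \<open>F\<close>.\<close>

lemma essential_ofE:
  assumes A: "A \<subseteq> P" and F: "essential_of P A F" and c: "c \<in> A - F"
  shows "diff_subgroup (A - F) \<noteq> UNIV"
    and "\<And>a. a \<in> A - F \<Longrightarrow> a - c \<in> diff_subgroup (A - F)"
    and "\<And>a. a \<in> F \<Longrightarrow> a - c \<notin> diff_subgroup (A - F)"
proof -
  let ?K = "diff_subgroup (A - F)"
  have ess: "finite F" "basis_of P A" "F \<subseteq> A" "\<not> basis_of P (A - F)"
    "\<And>F'. exceptional_of P A F' \<Longrightarrow> F' \<subseteq> F \<Longrightarrow> F' = F"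
    using F unfolding essential_of_def exceptional_of_def by auto
  show proper: "?K \<noteq> UNIV"
    using basis_of_remove_finite ess A by blast
  show coset: "a - c \<in> ?K" if "a \<in> A - F" for a
    using that c diff_subgroupI[of a "Suc 0"] by simp
  obtain n where n: "finite (P - nsum n A)"
    using ess(2) unfolding basis_of_def by blast
  obtain R where R: "finite R" "\<And>g. \<exists>r\<in>R. g - r \<in> ?K"
    using finite_cosets_of_basis[OF add_subgroup_diff_subgroup n ess(1)] coset by blast
  show "a - c \<notin> ?K" if "a \<in> F" for a
  proof
    assume "a - c \<in> ?K"
    then have "\<not> basis_of P (A - (F - {a}))"
      using coset by (intro not_basis_of_coset[OF add_subgroup_diff_subgroup proper R]) blast
    then have "exceptional_of P A (F - {a})"
      unfolding exceptional_of_def using ess by blast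
    then show False
      using ess(5) that by blast
  qed
qed

lemma translate_into:
  assumes "finite U"
  shows "\<exists>t\<in>P. (+) t ` U \<subseteq> P"
  using assms
proof induction
  case empty
  then show ?case
    using differences by blast
next
  case (insert u U)
  then obtain t where t: "t \<in> P" "(+) t ` U \<subseteq> P"
    by blast
  obtain x y where xy: "x \<in> P" "y \<in> P" "u = x - y"
    using differences by blast
  \<comment> \<open>Adding \<open>y\<close> to the shift turns the translate of \<open>u\<close>
    into \<open>t + x\<close> and keeps the earlier translates in \<open>P\<close>.\<close>
  have "(t + y) + u \<in> P"
    using add_closed[OF t(1) xy(1)] xy(3) by simp
  moreover have "(t + y) + v \<in> P" if "v \<in> U" for v
  proof -
    have "(t + v) + y \<in> P"
      using add_closed t(2) that xy(2) by blast
    then show ?thesis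
      by (simp add: ac_simps)
  qed
  ultimately show ?case
    using add_closed[OF t(1) xy(2)] by (intro bexI[of _ "t + y"]) auto
qed

text \<open>Each coset contains infinitely many elements of \<open>P\<close>, so one of them is a
  sum not made of \<open>U\<close> alone; splitting off a summand congruent to \<open>c\<close>
  leaves length \<open>n\<close>.\<close>

lemma nsum_meets_cosets:
  assumes H: "add_subgroup H" and R: "finite R" "\<And>g. \<exists>r\<in>R. g - r \<in> H"
    and A: "finite (P - nsum (Suc n) A)"
    and U: "finite U" "\<And>a. a \<in> A \<Longrightarrow> a \<in> U \<or> a - c \<in> H"
  shows "\<exists>y\<in>nsum n A. g - y - c \<in> H"
proof -
  have "infinite ({x \<in> P. g - x \<in> H} - ((P - nsum (Suc n) A) \<union> nsum (Suc n) U))"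
    using infinite_coset[OF H R] A finite_nsum[OF U(1)] by (simp add: Diff_infinite_finite del: nsum.simps)
  then obtain x where x: "g - x \<in> H" "x \<in> nsum (Suc n) A" "x \<notin> nsum (Suc n) U"
    by (blast dest: infinite_imp_nonempty)
  have "A \<subseteq> U \<union> {a. a - c \<in> H}"
    using U(2) by blast
  then have "x \<in> {a. a - c \<in> H} + nsum n A"
    using nsum_Suc_split x by blast
  then obtain a y where y: "x = a + y" "a - c \<in> H" "y \<in> nsum n A"
    by (auto elim: set_plus_elim)
  have "g - y - c \<in> H"
    using add_subgroup_add[OF H x(1) y(2)] y(1) by (simp add: algebra_simps)
  then show ?thesis
    using y(3) by blast
qed

text \<open>Fix a sum \<open>y r\<close> for each of the finitely many classes \<open>r\<close>. If
  \<open>x \<in> P\<close> has class \<open>r\<close> and \<open>x = y r + z\<close> with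
  \<open>z \<in> P\<close>, then \<open>z\<close> is congruent to \<open>c\<close>, so
  \<open>z \<in> B\<close>. Only elements outside \<open>y r + P\<close> can fail.\<close>

lemma finite_Diff_nsum_of_cosets:
  assumes H: "add_subgroup H" and R: "finite R" "\<And>g. \<exists>r\<in>R. g - r \<in> H"
    and B: "B \<subseteq> P" "\<And>x. x \<in> P \<Longrightarrow> x - c \<in> H \<Longrightarrow> x \<in> B"
    and cover: "\<And>g. \<exists>y\<in>nsum n B. g - y - c \<in> H"
  shows "finite (P - nsum (Suc n) B)"
proof -
  obtain y where y: "\<And>g. y g \<in> nsum n B" "\<And>g. g - y g - c \<in> H"
    using cover by metis
  have "P - nsum (Suc n) B \<subseteq> (\<Union>r\<in>R. P - (+) (y r) ` P)"
  proof
    fix x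
    assume x: "x \<in> P - nsum (Suc n) B"
    obtain r where r: "r \<in> R" "x - r \<in> H"
      using R(2) by blast
    have "x \<notin> (+) (y r) ` P"
    proof
      assume "x \<in> (+) (y r) ` P"
      then obtain z where z: "z \<in> P" "x = y r + z"
        by blast
      have "z - c \<in> H"
        using add_subgroup_add[OF H r(2) y(2)[of r]] z(2) by (simp add: algebra_simps)
      then have "z + y r \<in> nsum (Suc n) B"
        using B(2) z(1) y(1) by auto
      then show False
        using x z(2) by (simp add: ac_simps)
    qed
    then show "x \<in> (\<Union>r\<in>R. P - (+) (y r) ` P)"
      using r x by blast
  qed
  moreover have "finite (\<Union>r\<in>R. P - (+) (y r) ` P)"
    using R(1) finite_Diff_translate_nsum[OF B(1) y(1)] by blast
  ultimately show ?thesis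
    using finite_subset by blast
qed

end

section \<open>Transfer of essential subsets between two subsemigroups\<close>

lemma nsum_translate_mod:
  assumes H: "add_subgroup H" and AB: "\<And>a. a \<in> A \<Longrightarrow> \<exists>b\<in>B. b - a - t \<in> H"
  shows "\<exists>s. \<forall>x\<in>nsum n A. \<exists>y\<in>nsum n B. y - x - s \<in> H"
proof (induction n)
  case 0
  then show ?case
    using add_subgroup_zero[OF H] by (auto intro: exI[of _ 0])
next
  case (Suc n)
  then obtain s where s: "\<forall>x\<in>nsum n A. \<exists>y\<in>nsum n B. y - x - s \<in> H"
    by blast
  have "\<exists>y\<in>nsum (Suc n) B. y - x - (t + s) \<in> H" if "x \<in> nsum (Suc n) A" for x
  proof -
    obtain a z where x: "x = a + z" "a \<in> A" "z \<in> nsum n A"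
      using \<open>x \<in> nsum (Suc n) A\<close> by (rule nsum_SucE)
    obtain b where b: "b \<in> B" "b - a - t \<in> H"
      using AB x(2) by blast
    obtain y where y: "y \<in> nsum n B" "y - z - s \<in> H"
      using s x(3) by blast
    have "(b + y) - x - (t + s) \<in> H"
      using add_subgroup_add[OF H b(2) y(2)] x(1) by (simp add: algebra_simps)
    then show ?thesis
      using b(1) y(1) by (auto intro!: bexI[of _ "b + y"])
  qed
  then show ?case
    by blast
qed

lemma essential_of_transfer:
  fixes P Q :: "'g::ab_group_add set"
  assumes P: "translatable_subset P" and Q: "translatable_subset Q"
    and h: "h \<ge> 1" and A: "A \<subseteq> P" "finite (P - nsum h A)"
    and FF: "finite FF" "\<And>F. F \<in> FF \<Longrightarrow> essential_of P A F"
  shows "\<exists>t B. B \<subseteq> Q \<and> finite (Q - nsum h B) \<and> (\<forall>F\<in>FF. essential_of Q B ((+) t ` F))"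
proof -
  interpret P: translatable_subset P by (rule P)
  interpret Q: translatable_subset Q by (rule Q)
  define U where "U = \<Union>FF"
  have FF': "finite F" "F \<subseteq> A" "F \<subseteq> U" if "F \<in> FF" for F
    using FF(2)[OF that] that unfolding essential_of_def exceptional_of_def U_def by auto
  have U: "finite U" "U \<subseteq> A"
    using FF(1) FF' unfolding U_def by blast+
  have "infinite (A - U)"
    using P.infinite_basis[OF A(2)] U(1) by (simp add: Diff_infinite_finite)
  \<comment> \<open>Being outside \<open>U\<close>, this single \<open>c\<close> is a base point for
    the cosets of all \<open>K F\<close>.\<close>
  then obtain c where c: "c \<in> A" "c \<notin> U"
    by (metis DiffE all_not_in_conv finite.emptyI)
  define K where "K F = diff_subgroup (A - F)" for F
  define H where "H = (\<Inter>F\<in>FF. K F)"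
  have K: "add_subgroup (K F)" for F
    unfolding K_def by (rule add_subgroup_diff_subgroup)
  have K_proper: "K F \<noteq> UNIV"
    and K_coset: "\<And>a. a \<in> A - F \<Longrightarrow> a - c \<in> K F"
    and K_disjoint: "\<And>a. a \<in> F \<Longrightarrow> a - c \<notin> K F" if "F \<in> FF" for F
    using P.essential_ofE[OF A(1) FF(2)[OF that], of c] FF'(3)[OF that] c
    unfolding K_def by auto
  \<comment> \<open>hidden\<close>
  have H: "add_subgroup H"
    unfolding H_def by (intro add_subgroup_INT K)
  have HK: "H \<subseteq> K F" if "F \<in> FF" for F
    using that unfolding H_def by blast
  have H_coset: "a \<in> U \<or> a - c \<in> H" if "a \<in> A" for a
    using that K_coset unfolding H_def U_def by blast
  have H_disjoint: "a - c \<notin> H" if "a \<in> U" for a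
    using that K_disjoint unfolding H_def U_def by blast
  obtain R where R: "finite R" "\<And>g. \<exists>r\<in>R. g - r \<in> H"
    using P.finite_cosets_of_basis[OF H A(2) U(1)] H_coset by blast
  have RK: "\<exists>r\<in>R. g - r \<in> K F" if "F \<in> FF" for F g
    using R(2) HK[OF that] by blast
  obtain t where t: "(+) t ` U \<subseteq> Q"
    using Q.translate_into[OF U(1)] by blast
  define B where "B = (+) t ` U \<union> {x \<in> Q. x - (t + c) \<in> H}"
  have BQ: "B \<subseteq> Q"
    using t unfolding B_def by blast
  have transfer: "finite (Q - nsum n (B - (+) t ` F))"
    if n: "n \<ge> 1" "finite (P - nsum n (A - F))" and F: "F \<subseteq> U" for n F
  proof -
    obtain m where m: "n = Suc m"
      using n(1) by (cases n) auto
    let ?B = "B - (+) t ` F"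
    have coset_B: "x \<in> ?B" if "x \<in> Q" "x - (t + c) \<in> H" for x
    proof -
      have "x \<notin> (+) t ` F"
      proof
        assume "x \<in> (+) t ` F"
        then obtain u where "u \<in> F" "x = t + u"
          by blast
        then show False
          using H_disjoint[of u] F that(2) by auto
      qed
      then show ?thesis
        using that unfolding B_def by blast
    qed
    obtain d where d: "d \<in> Q" "(t + c) - d \<in> H"
      using Q.coset_representatives[OF H R(1)] R(2) by blast
    have d': "d - (t + c) \<in> H"
      using add_subgroup_uminus[OF H d(2)] by simp
    have "\<exists>b\<in>?B. b - a - t \<in> H" if "a \<in> A - F" for a
    proof (cases "a \<in> U")
      case True
      then have "t + a \<in> ?B"
        using that unfolding B_def by auto
      then show ?thesis
        using add_subgroup_zero[OF H] by (intro bexI[of _ "t + a"]) auto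
    next
      case False
      then have "a - c \<in> H"
        using H_coset that by blast
      then have "d - a - t \<in> H"
        using add_subgroup_diff[OF H d'] by (fastforce simp: algebra_simps)
      then show ?thesis
        using coset_B[OF d(1) d'] by blast
    qed
    then obtain s where s: "\<And>x. x \<in> nsum m (A - F) \<Longrightarrow> \<exists>y\<in>nsum m ?B. y - x - s \<in> H"
      using nsum_translate_mod[OF H, of "A - F" ?B t m] by blast
    have "\<exists>y\<in>nsum m ?B. g - y - (t + c) \<in> H" for g
    proof -
      have "\<exists>y\<in>nsum m (A - F). (g - s - t) - y - c \<in> H"
        using n(2) H_coset unfolding m by (intro P.nsum_meets_cosets[OF H R _ U(1)]) auto
      then obtain x where x: "x \<in> nsum m (A - F)" "(g - s - t) - x - c \<in> H"
        by blast
      obtain y where y: "y \<in> nsum m ?B" "y - x - s \<in> H"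
        using s[OF x(1)] by blast
      have "g - y - (t + c) \<in> H"
        using add_subgroup_diff[OF H x(2) y(2)] by (simp add: algebra_simps)
      then show ?thesis
        using y(1) by blast
    qed
    then show ?thesis
      unfolding m using coset_B BQ by (intro Q.finite_Diff_nsum_of_cosets[OF H R]) auto
  qed
  have hB: "finite (Q - nsum h B)"
    using transfer[of h "{}"] h A(2) by simp
  have "essential_of Q B ((+) t ` F)" if F: "F \<in> FF" for F
    unfolding essential_of_def
  proof (intro conjI allI impI)
    show "finite ((+) t ` F)"
      using FF'(1)[OF F] by simp
    have "x - (t + c) \<in> K F" if "x \<in> B - (+) t ` F" for x
    proof (cases "x \<in> (+) t ` U")
      case True
      then obtain u where "x = t + u" "u \<in> U"
        by blast
      then show ?thesis
        using that K_coset[OF F, of u] U(2) by auto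
    next
      case False
      then show ?thesis
        using that HK[OF F] unfolding B_def by blast
    qed
    then have "\<not> basis_of Q (B - (+) t ` F)"
      by (rule Q.not_basis_of_coset[OF K K_proper[OF F] R(1) RK[OF F]])
    then show "exceptional_of Q B ((+) t ` F)"
      unfolding exceptional_of_def using hB h FF'(3)[OF F]
      by (auto simp: B_def basis_of_def)
  next
    fix F'
    assume F': "exceptional_of Q B F' \<and> F' \<subseteq> (+) t ` F"
    then obtain E where E: "E \<subseteq> F" "F' = (+) t ` E"
      by (auto simp: subset_image_iff)
    have "\<not> basis_of P (A - E)"
    proof
      assume "basis_of P (A - E)"
      then have "basis_of Q (B - F')"
        unfolding basis_of_def E(2) using transfer E(1) FF'(3)[OF F] by blast
      then show False
        using F' unfolding exceptional_of_def by blast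
    qed
    then have "exceptional_of P A E"
      using FF(2)[OF F] E(1) unfolding essential_of_def exceptional_of_def by blast
    then have "E = F"
      using FF(2)[OF F] E(1) unfolding essential_of_def by blast
    then show "F' = (+) t ` F"
      using E(2) by simp
  qed
  then show ?thesis
    using BQ hB by blast
qed

lemma ecard_leI:
  assumes "\<And>Y. finite Y \<Longrightarrow> Y \<subseteq> X \<Longrightarrow> enat (card Y) \<le> m"
  shows "ecard X \<le> m"
proof (cases "finite X")
  case True
  then show ?thesis
    using assms[of X] by (simp add: ecard_def)
next
  case False
  have "enat n \<le> m" for n
    using infinite_arbitrarily_large[OF False, of n] assms by metis
  then have "m = \<infinity>"
    by (metis enat_ord_simps(1) not_infinity_eq Suc_n_not_le_n)
  then show ?thesis
    by simp
qed

lemma card_le_ecard: "finite Y \<Longrightarrow> Y \<subseteq> X \<Longrightarrow> enat (card Y) \<le> ecard X"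
  by (auto simp: ecard_def card_mono)

lemma max_essential_of_le:
  fixes P Q :: "'g::ab_group_add set"
  assumes P: "translatable_subset P" and Q: "translatable_subset Q" and h: "h \<ge> 1"
  shows "max_essential_of P h k \<le> max_essential_of Q h k"
  unfolding max_essential_of_def[of P]
proof (intro SUP_least ecard_leI)
  fix A Y
  assume A: "A \<in> {A. A \<subseteq> P \<and> finite (P - nsum h A)}"
    and Y: "finite Y" "Y \<subseteq> {F. essential_of P A F \<and> card F = k}"
  have A': "A \<subseteq> P" "finite (P - nsum h A)"
    using A by simp_all
  have ess: "essential_of P A F" if "F \<in> Y" for F
    using that Y(2) by blast
  obtain t B where B: "B \<subseteq> Q" "finite (Q - nsum h B)"
    "\<And>F. F \<in> Y \<Longrightarrow> essential_of Q B ((+) t ` F)"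
    using essential_of_transfer[OF P Q h A' Y(1) ess] by metis
  have "card Y = card ((`) ((+) t) ` Y)"
    by (rule card_image[symmetric]) (simp add: inj_on_def inj_image_eq_iff)
  also have "enat \<dots> \<le> ecard {F. essential_of Q B F \<and> card F = k}"
  proof (rule card_le_ecard)
    show "(`) ((+) t) ` Y \<subseteq> {F. essential_of Q B F \<and> card F = k}"
      using B(3) Y(2) by (auto simp: card_image)
  qed (use Y in simp)
  also have "\<dots> \<le> max_essential_of Q h k"
    unfolding max_essential_of_def using B by (intro SUP_upper) blast
  finally show "enat (card Y) \<le> max_essential_of Q h k" .
qed

context
  fixes f :: "'a::translatable_semigroup \<Rightarrow> 'g::ab_group_add"
  assumes inj_f: "inj f" and f_add: "f (x + y) = f x + f y"
begin

lemma image_sumset: "n \<ge> 1 \<Longrightarrow> f ` sumset n A = nsum n (f ` A)"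
proof (induction n A rule: sumset.induct)
  case (3 n A)
  have "f ` (A + X) = f ` A + f ` X" for X
    by (force simp: set_plus_def f_add)
  then show ?case
    using 3 by simp
qed auto

lemma almost_eq_iff: "n \<ge> 1 \<Longrightarrow> sumset n A \<sim> UNIV \<longleftrightarrow> finite (range f - nsum n (f ` A))"
  by (simp add: almost_eq_def finite_image_iff inj_on_subset[OF inj_f]
      flip: image_sumset image_set_diff[OF inj_f])

lemma additive_basis_iff: "additive_basis A \<longleftrightarrow> basis_of (range f) (f ` A)"
  unfolding additive_basis_def basis_of_def using almost_eq_iff by blast

lemma exceptional_iff: "exceptional A F \<longleftrightarrow> exceptional_of (range f) (f ` A) (f ` F)"
  unfolding exceptional_def exceptional_of_def additive_basis_iff
    image_set_diff[OF inj_f] inj_image_subset_iff[OF inj_f] ..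

lemma essential_iff: "essential A F \<longleftrightarrow> essential_of (range f) (f ` A) (f ` F)"
proof -
  have *: "(\<forall>X. exceptional_of (range f) (f ` A) X \<and> X \<subseteq> f ` F \<longrightarrow> X = f ` F) \<longleftrightarrow>
      (\<forall>F'. exceptional_of (range f) (f ` A) (f ` F') \<and> f ` F' \<subseteq> f ` F \<longrightarrow> f ` F' = f ` F)"
    by (metis subset_imageE)
  show ?thesis
    unfolding essential_def essential_of_def * exceptional_iff
    by (simp add: inj_image_subset_iff[OF inj_f] inj_image_eq_iff[OF inj_f]
        finite_image_iff inj_on_subset[OF inj_f])
qed

lemma ecard_essential:
  "ecard {F. essential A F \<and> card F = k} =
    ecard {F. essential_of (range f) (f ` A) F \<and> card F = k}"
proof -
  have "{F. essential_of (range f) (f ` A) F \<and> card F = k} =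
      (`) f ` {F. essential A F \<and> card F = k}"
  proof (intro set_eqI iffI)
    fix X
    assume X: "X \<in> {F. essential_of (range f) (f ` A) F \<and> card F = k}"
    then have "X \<subseteq> f ` A"
      by (simp add: essential_of_def exceptional_of_def)
    then obtain F where "X = f ` F"
      by (auto simp: subset_image_iff)
    then show "X \<in> (`) f ` {F. essential A F \<and> card F = k}"
      using X by (auto simp: essential_iff card_image inj_on_subset[OF inj_f])
  qed (auto simp: essential_iff card_image inj_on_subset[OF inj_f])
  moreover have "inj_on ((`) f) X" for X
    by (simp add: inj_on_def inj_image_eq_iff[OF inj_f])
  ultimately show ?thesis
    by (simp add: ecard_def finite_image_iff card_image)
qed

lemma max_essential_eq:
  assumes "h \<ge> 1"
  shows "max_essential TYPE('a) h k = max_essential_of (range f) h k"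
proof -
  have "{A. A \<subseteq> range f \<and> finite (range f - nsum h A)} = (`) f ` {A. sumset h A \<sim> UNIV}"
    by (auto simp: almost_eq_iff[OF assms] subset_image_iff)
  then show ?thesis
    unfolding max_essential_def max_essential_of_def
    by (simp add: image_image ecard_essential)
qed

lemma translatable_subset_range:
  assumes "\<And>g. \<exists>x y. g = f x - f y"
  shows "translatable_subset (range f)"
proof
  show "infinite (range f)"
    using infinite_semigroup inj_f by (simp add: finite_image_iff)
  show "finite (range f - (+) x ` range f)" if x: "x \<in> range f" for x
  proof -
    obtain a where a: "x = f a"
      using x by blast
    have "range f - (+) x ` range f \<subseteq> f ` (UNIV - range ((+) a))"
      unfolding a by (force simp flip: f_add)
    then show ?thesis
      using finite_Compl_translate[of a] finite_subset by blast
  qed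
  show "x + y \<in> range f" if "x \<in> range f" "y \<in> range f" for x y
    using that by (auto simp flip: f_add)
  show "\<exists>x\<in>range f. \<exists>y\<in>range f. g = x - y" for g
    using assms by blast
qed

end

theorem theorem8:
  fixes h k :: nat
  assumes "h \<ge> 1" and "k \<ge> 1"
  shows "max_essential TYPE('a::translatable_semigroup) h k = max_essential TYPE('a grothendieck) h k"
proof -
  let ?T = "range (groth_embed :: 'a \<Rightarrow> 'a grothendieck)"
  let ?G = "range (id :: 'a grothendieck \<Rightarrow> 'a grothendieck)"
  have T: "translatable_subset ?T"
    by (rule translatable_subset_range[OF inj_groth_embed groth_embed_add groth_embed_diff_surj])
  have G: "translatable_subset ?G"
    by (rule translatable_subset_range) (auto intro: exI[of _ 0] diff_0_right[symmetric])
  have "max_essential TYPE('a) h k = max_essential_of ?T h k"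
    by (intro max_essential_eq inj_groth_embed groth_embed_add assms(1))
  also have "\<dots> = max_essential_of ?G h k"
    by (intro antisym max_essential_of_le T G assms(1))
  also have "\<dots> = max_essential TYPE('a grothendieck) h k"
    by (intro max_essential_eq[symmetric] assms(1)) auto
  finally show ?thesis .
qed

end
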